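(* Let $I\in\mathbb{S}$ be fixed, let $f\in L^2(\mathbb{R},\mathbb{H})$ and $\varphi(t)=2^{1/4}e^{-\pi t^2}$. If $$\mathbb{K}_\varphi(\omega,x;\omega',x')=\int_{\mathbb{R}}e^{-2\pi I\omega't}\varphi(t-x')\,\overline{e^{-2\pi I\omega t}\varphi(t-x)}\,dt,$$ then $\mathbb{K}_\varphi(\omega,x;\omega',x')$ is the reproducing kernel (of the quaternion Gabor space $\mathcal{G}^\varphi_{\mathbb{H}}$), i.e. $$\mathcal{V}_\varphi f(x',\omega')=\int_{\mathbb{R}^2}\mathbb{K}_\varphi(\omega,x;\omega',x')\,\mathcal{V}_\varphi f(x,\omega)\,dx\,d\omega$$ for all $(x',\omega')\in\mathbb{R}^2$.
   Context: $\mathbb{H}$ is the algebra of real quaternions, $\mathbb{S}=\{q\in\mathbb{H}:q^2=-1\}$. $L^2(\mathbb{R},\mathbb{H})$ is the space of square integrable $\mathbb{H}$-valued functions. The quaternionic Segal-Bargmann transform with parameter $\nu=2\pi$ is $\mathcal{B}^S_{\mathbb{H}}(f)(q)=\int_{\mathbb{R}}2^{3/4}e^{-\pi(q^2+t^2)+2\pi\sqrt2\,qt}f(t)\,dt$, $q\in\mathbb{H}$. For $I\in\mathbb{S}$ fixed, the 1D quaternion short-time Fourier transform (QSTFT) of $f\in L^2(\mathbb{R},\mathbb{H})$ with window $\varphi$ is $$\mathcal{V}_\varphi f(x,\omega)=e^{-I\pi x\omega}\,\mathcal{B}^S_{\mathbb{H}}(f)\!\left(\frac{\bar q}{\sqrt2}\right)e^{-\frac{\pi|q|^2}{2}},\qquad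 q=x+I\omega,\ (x,\omega)\in\mathbb{R}^2.$$ The quaternion Gabor space with Gaussian window is $\mathcal{G}^\varphi_{\mathbb{H}}=\{\mathcal{V}_\varphi f: f\in L^2(\mathbb{R},\mathbb{H})\}$. *)

theory Defs
  imports "HOL-Analysis.Analysis"
begin

datatype quat = Quat (qRe: real) (qI: real) (qJ: real) (qK: real)

lemma quat_eq_iff:
  "p = q \<longleftrightarrow> qRe p = qRe q \<and> qI p = qI q \<and> qJ p = qJ q \<and> qK p = qK q"
  by (cases p; cases q) simp

instantiation quat :: real_vector
begin

definition zero_quat_def: "0 = Quat 0 0 0 0"
definition plus_quat_def:
  "p + q = Quat (qRe p + qRe q) (qI p + qI q) (qJ p + qJ q) (qK p + qK q)"
definition uminus_quat_def: "- q = Quat (- qRe q) (- qI q) (- qJ q) (- qK q)"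
definition minus_quat_def:
  "p - q = Quat (qRe p - qRe q) (qI p - qI q) (qJ p - qJ q) (qK p - qK q)"
definition scaleR_quat_def:
  "r *\<^sub>R q = Quat (r * qRe q) (r * qI q) (r * qJ q) (r * qK q)"

instance
  by standard
    (auto simp: quat_eq_iff zero_quat_def plus_quat_def uminus_quat_def minus_quat_def
      scaleR_quat_def algebra_simps)

end

lemma quat_sel_simps [simp]:
  "qRe 0 = 0" "qI 0 = 0" "qJ 0 = 0" "qK 0 = 0"
  "qRe (p + q) = qRe p + qRe q" "qI (p + q) = qI p + qI q"
  "qJ (p + q) = qJ p + qJ q" "qK (p + q) = qK p + qK q"
  "qRe (- q) = - qRe q" "qI (- q) = - qI q" "qJ (- q) = - qJ q" "qK (- q) = - qK q"
  "qRe (p - q) = qRe p - qRe q" "qI (p - q) = qI p - qI q"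
  "qJ (p - q) = qJ p - qJ q" "qK (p - q) = qK p - qK q"
  "qRe (r *\<^sub>R q) = r * qRe q" "qI (r *\<^sub>R q) = r * qI q"
  "qJ (r *\<^sub>R q) = r * qJ q" "qK (r *\<^sub>R q) = r * qK q"
  by (simp_all add: zero_quat_def plus_quat_def uminus_quat_def minus_quat_def scaleR_quat_def)

instantiation quat :: real_algebra_1
begin

definition one_quat_def: "1 = Quat 1 0 0 0"
definition times_quat_def:
  "p * q = Quat
     (qRe p * qRe q - qI p * qI q - qJ p * qJ q - qK p * qK q)
     (qRe p * qI q + qI p * qRe q + qJ p * qK q - qK p * qJ q)
     (qRe p * qJ q - qI p * qK q + qJ p * qRe q + qK p * qI q)
     (qRe p * qK q + qI p * qJ q - qJ p * qI q + qK p * qRe q)"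

instance
  by standard
    (auto simp: quat_eq_iff one_quat_def times_quat_def algebra_simps)

end

lemma quat_sel_one [simp]: "qRe 1 = 1" "qI 1 = 0" "qJ 1 = 0" "qK 1 = 0"
  by (simp_all add: one_quat_def)

lemma quat_sel_times [simp]:
  "qRe (p * q) = qRe p * qRe q - qI p * qI q - qJ p * qJ q - qK p * qK q"
  "qI (p * q) = qRe p * qI q + qI p * qRe q + qJ p * qK q - qK p * qJ q"
  "qJ (p * q) = qRe p * qJ q - qI p * qK q + qJ p * qRe q + qK p * qI q"
  "qK (p * q) = qRe p * qK q + qI p * qJ q - qJ p * qI q + qK p * qRe q"
  by (simp_all add: times_quat_def)

instantiation quat :: real_inner
begin

definition inner_quat_def:
  "inner p q = qRe p * qRe q + qI p * qI q + qJ p * qJ q + qK p * qK q"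
definition norm_quat_def: "norm (q::quat) = sqrt (inner q q)"
definition sgn_quat_def: "sgn (q::quat) = q /\<^sub>R norm q"
definition dist_quat_def: "dist (p::quat) q = norm (p - q)"
definition uniformity_quat_def [code del]:
  "(uniformity :: (quat \<times> quat) filter) = (INF e\<in>{0 <..}. principal {(x, y). dist x y < e})"
definition open_quat_def [code del]:
  "open (U :: quat set) \<longleftrightarrow> (\<forall>x\<in>U. eventually (\<lambda>(x', y). x' = x \<longrightarrow> y \<in> U) uniformity)"

instance
proof
  fix p q s :: quat and r :: real and U :: "quat set"
  show "dist p q = norm (p - q)" by (rule dist_quat_def)
  show "sgn p = p /\<^sub>R norm p" by (rule sgn_quat_def)
  show "(uniformity :: (quat \<times> quat) filter) = (INF e\<in>{0 <..}. principal {(x, y). dist x y < e})"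
    by (rule uniformity_quat_def)
  show "open U \<longleftrightarrow> (\<forall>x\<in>U. eventually (\<lambda>(x', y). x' = x \<longrightarrow> y \<in> U) uniformity)"
    by (rule open_quat_def)
  show "norm p = sqrt (inner p p)" by (rule norm_quat_def)
  show "inner p q = inner q p" "inner (p + q) s = inner p s + inner q s"
    "inner (r *\<^sub>R p) q = r * inner p q" "0 \<le> inner p p"
    by (simp_all add: inner_quat_def algebra_simps)
  have "(inner p p = 0) = ((qRe p)\<^sup>2 + (qI p)\<^sup>2 + (qJ p)\<^sup>2 + (qK p)\<^sup>2 = 0)"
    by (simp add: inner_quat_def power2_eq_square)
  then show "(inner p p = 0) = (p = 0)"
    by (simp add: add_nonneg_eq_0_iff quat_eq_iff)
qed

end

instance quat :: real_normed_algebra_1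
proof
  fix p q :: quat
  have "inner (p * q) (p * q) = inner p p * inner q q"
    unfolding inner_quat_def quat_sel_times by algebra
  then show "norm (p * q) \<le> norm p * norm q"
    by (simp add: norm_quat_def real_sqrt_mult)
  show "norm (1::quat) = 1"
    by (simp add: norm_quat_def inner_quat_def)
qed

instantiation quat :: euclidean_space
begin

definition Basis_quat_def:
  "Basis = {Quat 1 0 0 0, Quat 0 1 0 0, Quat 0 0 1 0, Quat 0 0 0 1}"

instance
proof
  fix u v q :: quat
  show "(Basis :: quat set) \<noteq> {}" "finite (Basis :: quat set)"
    by (simp_all add: Basis_quat_def)
  have B: "u \<in> Basis \<longleftrightarrow>
      u = Quat 1 0 0 0 \<or> u = Quat 0 1 0 0 \<or> u = Quat 0 0 1 0 \<or> u = Quat 0 0 0 1" for u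
    unfolding Basis_quat_def by blast
  show "inner u v = (if u = v then 1 else 0)" if "u \<in> Basis" "v \<in> Basis"
    using that unfolding B inner_quat_def by (elim disjE) simp_all
  have "(\<forall>u\<in>Basis. inner q u = 0) \<longleftrightarrow> qRe q = 0 \<and> qI q = 0 \<and> qJ q = 0 \<and> qK q = 0"
    unfolding Basis_quat_def ball_simps inner_quat_def quat.sel by simp
  then show "(\<forall>u\<in>Basis. inner q u = 0) = (q = 0)"
    unfolding quat_eq_iff by simp
qed

end

definition qcnj :: "quat \<Rightarrow> quat" where
  "qcnj q = Quat (qRe q) (- qI q) (- qJ q) (- qK q)"

definition imag_units :: "quat set" where
  "imag_units = {q. q\<^sup>2 = - 1}"

text \<open>
  Elements of \<open>L\<^sup>2\<close> are represented by functions rather than by almost-everywhere classes.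
  The exponential of a quaternion is the power series \<^const>\<open>exp\<close>.
\<close>

definition L2_quat :: "(real \<Rightarrow> quat) set" where
  "L2_quat = {f \<in> borel_measurable lebesgue. integrable lebesgue (\<lambda>t. (norm (f t))\<^sup>2)}"

definition bargmann :: "(real \<Rightarrow> quat) \<Rightarrow> quat \<Rightarrow> quat" where
  "bargmann f q = (LINT t|lebesgue.
     of_real (2 powr (3/4))
       * exp (- of_real pi * (q\<^sup>2 + (of_real t)\<^sup>2) + of_real (2 * pi * sqrt 2) * q * of_real t)
       * f t)"

text \<open>
  The transform is the one with the Gaussian window; its defining formula absorbs the window
  into the Segal--Bargmann kernel.
\<close>

definition qstft :: "quat \<Rightarrow> (real \<Rightarrow> quat) \<Rightarrow> real \<times> real \<Rightarrow> quat" where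
  "qstft I f = (\<lambda>(x, \<omega>).
     let q = of_real x + I * of_real \<omega> in
       exp (- I * of_real (pi * x * \<omega>))
         * bargmann f (qcnj q /\<^sub>R sqrt 2)
         * of_real (exp (- pi * (norm q)\<^sup>2 / 2)))"

definition gabor_space :: "quat \<Rightarrow> (real \<times> real \<Rightarrow> quat) set" where
  "gabor_space I = qstft I ` L2_quat"

definition gauss_window :: "real \<Rightarrow> real" where
  "gauss_window t = 2 powr (1/4) * exp (- pi * t\<^sup>2)"

definition gabor_kernel ::
  "quat \<Rightarrow> (real \<Rightarrow> real) \<Rightarrow> real \<Rightarrow> real \<Rightarrow> real \<Rightarrow> real \<Rightarrow> quat" where
  "gabor_kernel I \<phi> \<omega> x \<omega>' x' = (LINT t|lebesgue.
     exp (- 2 * of_real pi * I * of_real (\<omega>' * t)) * of_real (\<phi> (t - x'))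
       * qcnj (exp (- 2 * of_real pi * I * of_real (\<omega> * t)) * of_real (\<phi> (t - x))))"

text \<open>
  The space \<open>G\<close> is viewed inside the right-quaternionic Hilbert space of square integrable
  functions on the plane, with inner product \<open>\<langle>F, H\<rangle> = \<integral> qcnj (H z) * F z dz\<close>.  Hence the
  representer of evaluation at \<open>z'\<close> is \<open>\<lambda>z. qcnj (K z z')\<close>, and it has to lie in \<open>G\<close>.
\<close>

definition reproducing_kernel_of ::
  "(real \<times> real \<Rightarrow> quat) set \<Rightarrow> (real \<times> real \<Rightarrow> real \<times> real \<Rightarrow> quat) \<Rightarrow> bool" where
  "reproducing_kernel_of G K \<longleftrightarrow>
     (\<forall>z'. (\<lambda>z. qcnj (K z z')) \<in> G) \<and>
     (\<forall>F\<in>G. \<forall>z'. integrable lebesgue (\<lambda>z. K z z' * F z) \<and>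
        F z' = (LINT z|lebesgue. K z z' * F z))"

end

theory Submission
  imports Defs "HOL-Probability.Characteristic_Functions"
begin

text \<open>
  Put \<open>\<pi>\<^sub>z(t) = e\<^bsup>-2\<pi>I\<omega>t\<^esup> \<phi>(t - x)\<close> for \<open>z = (x, \<omega>)\<close>. Completing the square in the
  Segal--Bargmann kernel shows that the transform of \<open>f\<close> at \<open>z\<close> is \<open>\<surd>2 \<integral> \<pi>\<^sub>z(t) f(t) dt\<close>.
  Everything except \<open>f\<close> takes values in the commutative slice \<open>\<real> + \<real>I\<close>, a copy of the complex
  numbers, and stands to the left of \<open>f\<close>. Using Fubini's theorem, the reproducing formula therefore
  reduces to the complex identity \<open>\<integral> K(z, w) \<pi>\<^sub>z(t) dz = \<pi>\<^sub>w(t)\<close>, in which \<open>K\<close>, being the Gram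
  kernel of the functions \<open>\<pi>\<^sub>z\<close>, is an explicit Gaussian; all integrals are instances of the Fourier
  transform of a Gaussian. Fubini applies because \<open>K(\<cdot>, w)\<close> is integrable and
  \<open>\<integral> |\<pi>\<^sub>z(t) f(t)| dt\<close> is bounded uniformly in \<open>z\<close>. The representer of evaluation at \<open>w\<close> is the
  transform of the conjugate of \<open>\<pi>\<^sub>w\<close> divided by \<open>\<surd>2\<close>.
\<close>

section \<open>The slice of an imaginary unit\<close>

lemma imag_unitsD:
  assumes "I \<in> imag_units"
  shows "qRe I = 0" "I * I = - 1" "(qI I)\<^sup>2 + (qJ I)\<^sup>2 + (qK I)\<^sup>2 = 1"
proof -
  show *: "I * I = - 1" using assms by (simp add: imag_units_def power2_eq_square)
  then have e: "qRe I * qRe I - qI I * qI I - qJ I * qJ I - qK I * qK I = - 1"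
    "qRe I * qI I = 0" "qRe I * qJ I = 0" "qRe I * qK I = 0"
    by (auto simp: quat_eq_iff)
  show r: "qRe I = 0"
  proof (rule ccontr)
    assume "qRe I \<noteq> 0"
    \<comment> \<open>A nonzero real part would make the three imaginary components vanish, by the
      mixed equations in \<open>e\<close>; a real square would then equal -1.\<close>
    then have "qRe I * qRe I = - 1" using e by simp
    then show False by (metis neg_0_le_iff_le not_one_le_zero zero_le_square)
  qed
  show "(qI I)\<^sup>2 + (qJ I)\<^sup>2 + (qK I)\<^sup>2 = 1"
    using e(1) r by (simp add: power2_eq_square)
qed

text \<open>For an imaginary unit this is the isometric embedding of the complex algebra sending
  \<open>\<i>\<close> to \<open>I\<close>; it allows commutative computations to be done over the
  complex numbers and then transported.\<close>

definition slice :: "quat \<Rightarrow> complex \<Rightarrow> quat" where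
  "slice I z = of_real (Re z) + Im z *\<^sub>R I"

lemma quat_sel_of_real [simp]:
  "qRe (of_real r) = r" "qI (of_real r) = 0" "qJ (of_real r) = 0" "qK (of_real r) = 0"
  by (simp_all add: of_real_def)

lemma slice_add: "slice I (z + w) = slice I z + slice I w"
  by (simp add: slice_def algebra_simps)

lemma slice_minus: "slice I (- z) = - slice I z"
  by (simp add: slice_def)

lemma slice_diff: "slice I (z - w) = slice I z - slice I w"
  by (simp add: slice_def algebra_simps)

lemma slice_scaleR: "slice I (r *\<^sub>R z) = r *\<^sub>R slice I z"
  by (simp add: slice_def algebra_simps scaleR_conv_of_real[of r "of_real _"])

lemma slice_of_real [simp]: "slice I (of_real r) = of_real r"
  by (simp add: slice_def)

lemma slice_ii [simp]: "slice I \<i> = I"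
  by (simp add: slice_def)

lemma slice_1 [simp]: "slice I 1 = 1"
  by (simp add: slice_def)

lemma slice_mult:
  assumes "I \<in> imag_units" shows "slice I (z * w) = slice I z * slice I w"
  using imag_unitsD[OF assms]
  by (auto simp: quat_eq_iff slice_def algebra_simps power2_eq_square) algebra+

lemma norm_slice [simp]:
  assumes "I \<in> imag_units" shows "norm (slice I z) = norm z"
proof -
  have "inner (slice I z) (slice I z) = (Re z)\<^sup>2 + (Im z)\<^sup>2 * ((qI I)\<^sup>2 + (qJ I)\<^sup>2 + (qK I)\<^sup>2)"
    using imag_unitsD(1)[OF assms]
    by (simp add: inner_quat_def slice_def power2_eq_square algebra_simps)
  then show ?thesis
    using imag_unitsD(3)[OF assms] by (simp add: norm_quat_def cmod_def)
qed

lemma bounded_linear_slice: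
  assumes "I \<in> imag_units" shows "bounded_linear (slice I)"
  using assms by (intro bounded_linear_intro[where K = 1]) (auto simp: slice_add slice_scaleR)

lemma slice_power:
  assumes "I \<in> imag_units" shows "slice I (z ^ n) = slice I z ^ n"
  by (induction n) (simp_all add: slice_mult assms)

text \<open>A bounded linear multiplicative map passes through the exponential series term by term,
  and limits are unique.\<close>

lemma slice_exp:
  assumes "I \<in> imag_units" shows "slice I (exp z) = exp (slice I z)"
proof -
  have "(\<lambda>n. slice I (z ^ n /\<^sub>R fact n)) sums slice I (exp z)"
    by (rule bounded_linear.sums[OF bounded_linear_slice[OF assms] exp_converges])
  then have "(\<lambda>n. slice I z ^ n /\<^sub>R fact n) sums slice I (exp z)"
    by (simp add: slice_scaleR slice_power assms)
  then show ?thesis using exp_converges sums_unique2 by blast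
qed

lemma slice_cnj:
  assumes "I \<in> imag_units" shows "slice I (cnj z) = qcnj (slice I z)"
  using imag_unitsD(1)[OF assms] by (simp add: slice_def quat_eq_iff qcnj_def)

text \<open>Euler's four-square identity, which gives equality where a general normed algebra has an
  inequality.\<close>

lemma norm_quat_mult: "norm (p * q :: quat) = norm p * norm q"
proof -
  have "inner (p * q) (p * q) = inner p p * inner q q"
    unfolding inner_quat_def quat_sel_times by algebra
  then show ?thesis by (simp add: norm_quat_def real_sqrt_mult)
qed

section \<open>Gaussian integrals\<close>

lemma char_std_normal_has_integral:
  "has_bochner_integral lborel (\<lambda>x. std_normal_density x *\<^sub>R iexp (s * x))
     (of_real (exp (- (s\<^sup>2) / 2)))"
proof -
  interpret N: prob_space std_normal_distribution
    by (rule prob_space_normal_density) simp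
  have "integrable std_normal_distribution (\<lambda>x. iexp (s * x))"
    by (intro N.integrable_const_bound[where B = 1] AE_I2) auto
  moreover have "(LINT x|std_normal_distribution. iexp (s * x)) = of_real (exp (- (s\<^sup>2) / 2))"
    using fun_cong[OF char_std_normal_distribution, of s] by (simp add: char_def)
  ultimately show ?thesis
    by (simp add: has_bochner_integral_iff integrable_density integral_density)
qed

text \<open>The characteristic function of the standard normal distribution after the affine
  substitution replacing x by c(x - m).\<close>

lemma has_integral_gauss_cis:
  fixes a b m :: real
  assumes "0 < a"
  shows "has_bochner_integral lborel
    (\<lambda>t. of_real (exp (- (pi * a * (t - m)\<^sup>2))) * cis (2 * pi * b * t))
    (of_real (exp (- (pi * b\<^sup>2 / a)) / sqrt a) * cis (2 * pi * b * m))"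
proof -
  \<comment> \<open>The scale satisfies c^2 / 2 = pi a, which turns the normal density into the
    required Gaussian; \<open>s\<close> is then fixed by s c = 2 pi b.\<close>
  define c where "c = sqrt (2 * pi * a)"
  define s where "s = 2 * pi * b / c"
  have c: "c > 0" "c\<^sup>2 = 2 * pi * a" using assms by (simp_all add: c_def)
  have s: "s\<^sup>2 / 2 = pi * b\<^sup>2 / a" "s * c = 2 * pi * b"
    using c assms by (simp_all add: s_def power_divide field_simps power2_eq_square)
  let ?F = "\<lambda>x. std_normal_density x *\<^sub>R iexp (s * x)"
  have "has_bochner_integral lborel (\<lambda>x. ?F (- c * m + c * x))
      (of_real (exp (- (s\<^sup>2) / 2)) /\<^sub>R \<bar>c\<bar>)"
    using char_std_normal_has_integral c by (subst lborel_has_bochner_integral_real_affine_iff[symmetric]) auto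
  \<comment> \<open>The factor \<open>sqrt (2 * pi)\<close> removes the normalisation of the
    density, and the \<open>cis\<close> factor undoes the phase caused by centring at
    \<open>m\<close>.\<close>
  then have *: "has_bochner_integral lborel
     (\<lambda>x. of_real (sqrt (2 * pi)) * cis (2 * pi * b * m) * ?F (- c * m + c * x))
     (of_real (sqrt (2 * pi)) * cis (2 * pi * b * m) * (of_real (exp (- (s\<^sup>2) / 2)) /\<^sub>R \<bar>c\<bar>))"
    by (intro has_bochner_integral_mult_right)
  have 1: "of_real (sqrt (2 * pi)) * cis (2 * pi * b * m) * ?F (- c * m + c * x) =
     of_real (exp (- (pi * a * (x - m)\<^sup>2))) * cis (2 * pi * b * x)" for x
  proof -
    have e: "(- c * m + c * x)\<^sup>2 / 2 = pi * a * (x - m)\<^sup>2"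
    proof -
      have "(- c * m + c * x)\<^sup>2 = c\<^sup>2 * (x - m)\<^sup>2" by (simp add: power2_eq_square algebra_simps)
      then show ?thesis by (simp add: c)
    qed
    have "s * (- c * m + c * x) = (s * c) * (x - m)"
      by (simp add: algebra_simps)
    then have "s * (- c * m + c * x) = 2 * pi * b * (x - m)"
      by (simp only: s(2))
    then have i: "iexp (s * (- c * m + c * x)) = cis (2 * pi * b * (x - m))"
      by (simp only: cis_conv_exp)
    have "cis (2 * pi * b * m) * cis (2 * pi * b * (x - m)) = cis (2 * pi * b * x)"
      by (simp add: cis_mult algebra_simps)
    then show ?thesis
      unfolding i std_normal_density_def minus_divide_left[symmetric] e scaleR_conv_of_real
      by (simp add: mult.assoc mult.left_commute)
  qed
  have 2: "of_real (sqrt (2 * pi)) * cis (2 * pi * b * m) * (of_real (exp (- (s\<^sup>2) / 2)) /\<^sub>R \<bar>c\<bar>) =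
     of_real (exp (- (pi * b\<^sup>2 / a)) / sqrt a) * cis (2 * pi * b * m)"
    using c(1) s(1) by (simp add: c_def real_sqrt_mult scaleR_conv_of_real field_simps)
  show ?thesis using * unfolding 1 2 .
qed

lemma has_integral_gauss:
  fixes a m :: real
  assumes "0 < a"
  shows "has_bochner_integral lborel (\<lambda>t. exp (- (pi * a * (t - m)\<^sup>2))) (1 / sqrt a)"
  using has_bochner_integral_bounded_linear[OF bounded_linear_Re has_integral_gauss_cis[OF assms, of m 0]]
  by simp

section \<open>Passage to the completed measure\<close>

text \<open>Explicit integrals are computed over \<open>lborel\<close>; this carries them to its
  completion \<open>lebesgue\<close>, over which the transforms are defined.\<close>

lemma has_bochner_integral_completion:
  fixes f :: "'a \<Rightarrow> 'b :: {banach, second_countable_topology}"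
  assumes "has_bochner_integral M f x" shows "has_bochner_integral (completion M) f x"
  using assms borel_measurable_has_bochner_integral[OF assms]
  by (simp add: has_bochner_integral_iff integrable_completion integral_completion)

text \<open>Makes Fubini available with \<open>lebesgue\<close> as a factor, as \<open>f\<close> is
  only Lebesgue measurable. A countable cover for \<open>M\<close> serves again, since the
  completion agrees with \<open>M\<close> on its sets.\<close>

lemma sigma_finite_completion:
  assumes "sigma_finite_measure M" shows "sigma_finite_measure (completion M)"
proof -
  obtain A where "countable A" "A \<subseteq> sets M" "\<Union>A = space M" "\<forall>a\<in>A. emeasure M a \<noteq> \<infinity>"
    using assms by (auto simp: sigma_finite_measure_def)
  then show ?thesis
    by (intro sigma_finite_measure.intro exI[of _ A]) (auto simp: subset_iff)
qed


section \<open>Time-frequency shifts of the Gaussian window\<close>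

definition gabor_atom :: "real \<times> real \<Rightarrow> real \<Rightarrow> complex" where
  "gabor_atom z t = of_real (gauss_window (t - fst z)) * cis (- (2 * pi * snd z * t))"

text \<open>The factors \<open>1/2\<close> are kept in the shape \<open>pi * a * (t - m)\<^sup>2\<close> of \<open>has_integral_gauss_cis\<close>.\<close>

definition gabor_gram :: "real \<times> real \<Rightarrow> real \<times> real \<Rightarrow> complex" where
  "gabor_gram z w =
     of_real (exp (- (pi * (1/2) * (fst z - fst w)\<^sup>2)) * exp (- (pi * (1/2) * (snd z - snd w)\<^sup>2)))
       * cis (pi * (snd z - snd w) * (fst z + fst w))"

text \<open>Hermitian symmetry of a Gram kernel: exchanging the points preserves the Gaussian
  factors and reverses the phase.\<close>

lemma cnj_gabor_gram: "cnj (gabor_gram z w) = gabor_gram w z"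
proof -
  have "- (pi * (snd z - snd w) * (fst z + fst w)) = pi * (snd w - snd z) * (fst w + fst z)"
    by (simp add: algebra_simps)
  then show ?thesis
    unfolding gabor_gram_def complex_cnj_mult complex_cnj_complex_of_real cis_cnj
    by (simp only: power2_commute[of "fst z"] power2_commute[of "snd z"])
qed

lemma gauss_window_nonneg [simp]: "0 \<le> gauss_window t"
  by (simp add: gauss_window_def)

lemma gauss_window_le: "gauss_window t \<le> 2 powr (1/4)"
  by (simp add: gauss_window_def)

lemma norm_gabor_atom [simp]: "norm (gabor_atom z t) = gauss_window (t - fst z)"
  by (simp add: gabor_atom_def norm_mult)

lemma borel_measurable_cis [measurable]: "cis \<in> borel_measurable borel"
  by (intro borel_measurable_continuous_onI continuous_on_cis continuous_intros)

lemma borel_measurable_cnj [measurable]: "cnj \<in> borel_measurable borel"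
  by (intro borel_measurable_continuous_onI continuous_on_cnj continuous_intros)

lemma measurable_gabor_gram [measurable]: "(\<lambda>z. gabor_gram z w) \<in> borel_measurable borel"
  unfolding gabor_gram_def borel_prod[symmetric] by measurable

lemma measurable_gabor_atom [measurable]:
  "(\<lambda>(z, t). gabor_atom z t) \<in> borel_measurable (borel \<Otimes>\<^sub>M borel)"
  unfolding gabor_atom_def gauss_window_def borel_prod[symmetric] by measurable

text \<open>Completing the square: (t - x)^2 + (t - y)^2 = (x - y)^2 / 2 + 2 (t - (x +
  y)/2)^2.\<close>

lemma gauss_window_mult:
  "gauss_window (t - x) * gauss_window (t - y) =
     sqrt 2 * exp (- (pi * (1/2) * (x - y)\<^sup>2)) * exp (- (pi * 2 * (t - (x + y) / 2)\<^sup>2))"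
proof -
  have "(2::real) powr (1/4) * 2 powr (1/4) = sqrt 2"
    by (simp add: powr_add[symmetric] powr_half_sqrt)
  moreover have "- pi * (t - x)\<^sup>2 + - pi * (t - y)\<^sup>2 =
     - (pi * (1/2) * (x - y)\<^sup>2) + - (pi * 2 * (t - (x + y) / 2)\<^sup>2)"
    by (simp add: power2_eq_square field_simps)
  then have "exp (- pi * (t - x)\<^sup>2) * exp (- pi * (t - y)\<^sup>2) =
     exp (- (pi * (1/2) * (x - y)\<^sup>2)) * exp (- (pi * 2 * (t - (x + y) / 2)\<^sup>2))"
    by (simp only: exp_add[symmetric])
  moreover have "gauss_window (t - x) * gauss_window (t - y) = (2 powr (1/4) * 2 powr (1/4)) *
      (exp (- pi * (t - x)\<^sup>2) * exp (- pi * (t - y)\<^sup>2))"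
    by (simp only: gauss_window_def mult_ac)
  ultimately show ?thesis by (simp only: mult.assoc)
qed

text \<open>The diagonal case of the product formula; the constant \<open>2 powr (1/4)\<close> is
  the one that normalises the window in L2.\<close>

lemma has_integral_gauss_window_sq:
  "has_bochner_integral lborel (\<lambda>t. (gauss_window (t - x))\<^sup>2) 1"
proof -
  have "has_bochner_integral lborel (\<lambda>t. sqrt 2 * exp (- (pi * 2 * (t - x)\<^sup>2))) (sqrt 2 * (1 / sqrt 2))"
    by (intro has_bochner_integral_mult_right has_integral_gauss) simp
  then show ?thesis
    using gauss_window_mult[of _ x x] by (simp add: power2_eq_square[of "gauss_window _"])
qed

text \<open>The product of the two windows is one Gaussian centred at the midpoint, so the integral
  is its Fourier transform at the difference of the frequencies.\<close>

lemma has_integral_gabor_atom_mult_cnj: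
  "has_bochner_integral lborel (\<lambda>t. gabor_atom w t * cnj (gabor_atom z t)) (gabor_gram z w)"
proof -
  obtain x \<omega> y \<eta> where z: "z = (x, \<omega>)" and w: "w = (y, \<eta>)" by (metis surj_pair)
  let ?c = "of_real (sqrt 2 * exp (- (pi * (1/2) * (x - y)\<^sup>2))) :: complex"
  let ?m = "(x + y) / 2"
  have "has_bochner_integral lborel
    (\<lambda>t. ?c * (of_real (exp (- (pi * 2 * (t - ?m)\<^sup>2))) * cis (2 * pi * (\<omega> - \<eta>) * t)))
    (?c * (of_real (exp (- (pi * (\<omega> - \<eta>)\<^sup>2 / 2)) / sqrt 2) * cis (2 * pi * (\<omega> - \<eta>) * ?m)))"
    by (intro has_bochner_integral_mult_right has_integral_gauss_cis) simp
  moreover have "?c * (of_real (exp (- (pi * 2 * (t - ?m)\<^sup>2))) * cis (2 * pi * (\<omega> - \<eta>) * t)) =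
    gabor_atom w t * cnj (gabor_atom z t)" for t
  proof -
    have "gabor_atom w t * cnj (gabor_atom z t) =
      of_real (gauss_window (t - x) * gauss_window (t - y)) *
        (cis (- (2 * pi * \<eta> * t)) * cis (2 * pi * \<omega> * t))"
      by (simp add: gabor_atom_def z w cis_cnj mult_ac)
    also have "cis (- (2 * pi * \<eta> * t)) * cis (2 * pi * \<omega> * t) = cis (2 * pi * (\<omega> - \<eta>) * t)"
      by (simp add: cis_mult algebra_simps)
    finally show ?thesis unfolding gauss_window_mult by (simp add: mult_ac)
  qed
  moreover have "?c * (of_real (exp (- (pi * (\<omega> - \<eta>)\<^sup>2 / 2)) / sqrt 2) * cis (2 * pi * (\<omega> - \<eta>) * ?m)) =
    gabor_gram z w"
  proof -
    have "2 * pi * (\<omega> - \<eta>) * ?m = pi * (\<omega> - \<eta>) * (x + y)" by simp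
    then show ?thesis by (simp only: gabor_gram_def z w fst_conv snd_conv) simp
  qed
  ultimately show ?thesis by simp
qed

text \<open>The phase has modulus one, and the modulus of the kernel is a product of two
  one-variable Gaussians.\<close>

lemma integrable_gabor_gram: "integrable lborel (\<lambda>z. gabor_gram z w)"
proof -
  have "integrable (lborel \<Otimes>\<^sub>M lborel) (\<lambda>z. gabor_gram z w)"
  proof (rule lborel_pair.Fubini_integrable)
    let ?g = "\<lambda>u m::real. exp (- (pi * (1/2) * (u - m)\<^sup>2))"
    have n: "norm (gabor_gram (x, y) w) = ?g x (fst w) * ?g y (snd w)" for x y
      by (simp add: gabor_gram_def norm_mult)
    have i: "integrable lborel (\<lambda>u. ?g u m)" for m
      using has_integral_gauss[of "1/2" m] by (simp add: has_bochner_integral_iff)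
    show "integrable lborel (\<lambda>x. LINT y|lborel. norm (gabor_gram (x, y) w))"
      unfolding n using i by simp
    show "AE x in lborel. integrable lborel (\<lambda>y. gabor_gram (x, y) w)"
    proof (rule AE_I2)
      fix x
      have "integrable lborel (\<lambda>y. norm (gabor_gram (x, y) w))"
        unfolding n using i by simp
      moreover have "(\<lambda>y. gabor_gram (x, y) w) \<in> borel_measurable lborel"
        unfolding gabor_gram_def by simp
      ultimately show "integrable lborel (\<lambda>y. gabor_gram (x, y) w)"
        by (simp add: integrable_norm_iff)
    qed
  qed (simp add: lborel_prod)
  then show ?thesis by (simp add: lborel_prod)
qed

text \<open>Integrating over the frequency first leaves \<open>gabor_atom w t\<close> times a
  Gaussian in the position, centred at \<open>t\<close> and of total mass one.\<close>

lemma has_integral_gabor_gram_mult_atom: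
  "has_bochner_integral lborel (\<lambda>z. gabor_gram z w * gabor_atom z t) (gabor_atom w t)"
proof -
  obtain y \<eta> where w: "w = (y, \<eta>)" by (metis surj_pair)
  have int: "integrable lborel (\<lambda>z. gabor_gram z w * gabor_atom z t)"
  proof (rule Bochner_Integration.integrable_bound)
    show "integrable lborel (\<lambda>z. gabor_gram z w * of_real (2 powr (1/4)))"
      by (intro integrable_mult_left integrable_gabor_gram)
    show "AE z in lborel. norm (gabor_gram z w * gabor_atom z t)
        \<le> norm (gabor_gram z w * of_real (2 powr (1/4)))"
      by (intro AE_I2) (simp add: norm_mult gauss_window_le mult_left_mono)
  qed simp
  have inner: "(LINT \<omega>|lborel. gabor_gram (x, \<omega>) w * gabor_atom (x, \<omega>) t) =
      gabor_atom w t * of_real (sqrt 2 * exp (- (pi * 2 * (x - t)\<^sup>2)))" for x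
  proof -
    \<comment> \<open>The coefficient of 2 pi \<omega> in the combined phase of kernel and
      atom.\<close>
    define b where "b = (x + y) / 2 - t"
    let ?A = "of_real (exp (- (pi * (1/2) * (x - y)\<^sup>2)) * gauss_window (t - x))
        * cis (- (pi * \<eta> * (x + y)))"
    have 1: "gabor_gram (x, \<omega>) w * gabor_atom (x, \<omega>) t =
        ?A * (of_real (exp (- (pi * (1/2) * (\<omega> - \<eta>)\<^sup>2))) * cis (2 * pi * b * \<omega>))" for \<omega>
    proof -
      have "cis (pi * (\<omega> - \<eta>) * (x + y)) * cis (- (2 * pi * \<omega> * t)) =
          cis (- (pi * \<eta> * (x + y))) * cis (2 * pi * b * \<omega>)"
      proof -
        have "pi * (\<omega> - \<eta>) * (x + y) + - (2 * pi * \<omega> * t) = - (pi * \<eta> * (x + y)) + 2 * pi * b * \<omega>"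
          by (simp add: b_def field_simps)
        then show ?thesis by (simp only: cis_mult)
      qed
      then show ?thesis
        by (simp add: gabor_gram_def gabor_atom_def w mult_ac)
    qed
    have "has_bochner_integral lborel
        (\<lambda>\<omega>. of_real (exp (- (pi * (1/2) * (\<omega> - \<eta>)\<^sup>2))) * cis (2 * pi * b * \<omega>))
        (of_real (exp (- (pi * b\<^sup>2 / (1/2))) / sqrt (1/2)) * cis (2 * pi * b * \<eta>))"
      by (rule has_integral_gauss_cis) simp
    from has_bochner_integral_integral_eq[OF has_bochner_integral_mult_right, OF this]
    have "(LINT \<omega>|lborel. gabor_gram (x, \<omega>) w * gabor_atom (x, \<omega>) t) =
        ?A * (of_real (exp (- (pi * b\<^sup>2 / (1/2))) / sqrt (1/2)) * cis (2 * pi * b * \<eta>))"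
      unfolding 1 .
    also have "\<dots> = of_real (exp (- (pi * (1/2) * (x - y)\<^sup>2)) * gauss_window (t - x)
          * (sqrt 2 * exp (- (pi * 2 * b\<^sup>2))))
          * (cis (- (pi * \<eta> * (x + y))) * cis (2 * pi * b * \<eta>))"
      by (simp add: real_sqrt_divide mult_ac)
    also have "cis (- (pi * \<eta> * (x + y))) * cis (2 * pi * b * \<eta>) = cis (- (2 * pi * \<eta> * t))"
      by (simp add: cis_mult b_def field_simps)
    also have "exp (- (pi * (1/2) * (x - y)\<^sup>2)) * gauss_window (t - x)
          * (sqrt 2 * exp (- (pi * 2 * b\<^sup>2))) =
        gauss_window (t - y) * (sqrt 2 * exp (- (pi * 2 * (x - t)\<^sup>2)))"
    proof -
      \<comment> \<open>With u = x - t and v = y - t, this is the parallelogram law (u - v)^2 / 2 +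
        (u + v)^2 / 2 = u^2 + v^2 with u^2 added to both sides.\<close>
      have "- (pi * (1/2) * (x - y)\<^sup>2) + - pi * (t - x)\<^sup>2 + - (pi * 2 * b\<^sup>2) =
          - pi * (t - y)\<^sup>2 + - (pi * 2 * (x - t)\<^sup>2)"
        by (simp add: b_def power2_eq_square field_simps)
      then have "exp (- (pi * (1/2) * (x - y)\<^sup>2)) * exp (- pi * (t - x)\<^sup>2) * exp (- (pi * 2 * b\<^sup>2)) =
          exp (- pi * (t - y)\<^sup>2) * exp (- (pi * 2 * (x - t)\<^sup>2))"
        by (simp only: exp_add[symmetric])
      moreover have "e1 * (c * e2) * (r * e3) = c * r * (e1 * e2 * e3)"
          "c * e1 * (r * e2) = c * r * (e1 * e2)" for c r e1 e2 e3 :: real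
        by (simp_all only: mult_ac)
      ultimately show ?thesis by (simp only: gauss_window_def)
    qed
    finally show ?thesis by (simp add: gabor_atom_def w mult_ac)
  qed
  have "has_bochner_integral lborel
      (\<lambda>x. gabor_atom w t * of_real (sqrt 2 * exp (- (pi * 2 * (x - t)\<^sup>2))))
      (gabor_atom w t * of_real (sqrt 2 * (1 / sqrt 2)))"
    by (intro has_bochner_integral_mult_right has_bochner_integral_of_real has_integral_gauss) simp
  then have "(LINT x|lborel. LINT \<omega>|lborel. gabor_gram (x, \<omega>) w * gabor_atom (x, \<omega>) t) = gabor_atom w t"
    unfolding inner by (simp add: has_bochner_integral_iff)
  moreover have "(LINT x|lborel. LINT \<omega>|lborel. gabor_gram (x, \<omega>) w * gabor_atom (x, \<omega>) t) =
      (LINT z|lborel. gabor_gram z w * gabor_atom z t)"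
    using lborel_pair.integral_fst'[of "\<lambda>z. gabor_gram z w * gabor_atom z t"] int
    by (simp add: lborel_prod)
  ultimately show ?thesis using int by (simp add: has_bochner_integral_iff)
qed

text \<open>Pointwise 2ab \<le> a^2 + b^2 and the unit L2 norm of the shifted window give a bound
  independent of \<open>x\<close>; this uniformity is what Fubini uses later.\<close>

lemma integrable_gauss_window_mult_L2:
  assumes "f \<in> L2_quat"
  shows "integrable lebesgue (\<lambda>t. gauss_window (t - x) * norm (f t))"
    and "(LINT t|lebesgue. gauss_window (t - x) * norm (f t))
           \<le> (1 + (LINT t|lebesgue. (norm (f t))\<^sup>2)) / 2"
proof -
  have f [measurable]: "f \<in> borel_measurable lebesgue"
    and f2: "integrable lebesgue (\<lambda>t. (norm (f t))\<^sup>2)"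
    using assms by (auto simp: L2_quat_def)
  have gm [measurable]: "(\<lambda>t. gauss_window (t - x)) \<in> borel_measurable borel"
    unfolding gauss_window_def by measurable
  then have [measurable]: "(\<lambda>t. gauss_window (t - x)) \<in> borel_measurable lebesgue"
    by (intro measurable_completion) simp
  have g: "integrable lebesgue (\<lambda>t. (gauss_window (t - x))\<^sup>2)"
      "(LINT t|lebesgue. (gauss_window (t - x))\<^sup>2) = 1"
    using has_bochner_integral_completion[OF has_integral_gauss_window_sq, of x]
    by (simp_all add: has_bochner_integral_iff)
  let ?b = "\<lambda>t. ((gauss_window (t - x))\<^sup>2 + (norm (f t))\<^sup>2) / 2"
  have le: "gauss_window (t - x) * norm (f t) \<le> ?b t" for t
    using sum_squares_bound[of "gauss_window (t - x)" "norm (f t)"] by simp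
  have b: "integrable lebesgue ?b" using g f2 by simp
  show i: "integrable lebesgue (\<lambda>t. gauss_window (t - x) * norm (f t))"
    by (rule Bochner_Integration.integrable_bound[OF b]) (use le in \<open>auto simp: abs_mult\<close>)
  have "(LINT t|lebesgue. gauss_window (t - x) * norm (f t)) \<le> (LINT t|lebesgue. ?b t)"
    by (rule integral_mono[OF i b le])
  also have "\<dots> = (1 + (LINT t|lebesgue. (norm (f t))\<^sup>2)) / 2"
    using g f2 by simp
  finally show "(LINT t|lebesgue. gauss_window (t - x) * norm (f t))
           \<le> (1 + (LINT t|lebesgue. (norm (f t))\<^sup>2)) / 2" .
qed


section \<open>The short-time Fourier transform\<close>

lemma measurable_slice [measurable]:
  assumes "I \<in> imag_units" shows "slice I \<in> borel_measurable borel"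
  by (intro borel_measurable_continuous_onI linear_continuous_on bounded_linear_slice assms)

lemma integrable_slice_gabor_atom_mult:
  assumes I: "I \<in> imag_units" and f: "f \<in> L2_quat"
  shows "integrable lebesgue (\<lambda>t. slice I (gabor_atom z t) * f t)"
proof (rule Bochner_Integration.integrable_bound)
  show "integrable lebesgue (\<lambda>t. gauss_window (t - fst z) * norm (f t))"
    by (rule integrable_gauss_window_mult_L2[OF f])
  have "(\<lambda>t. slice I (gabor_atom z t)) \<in> borel_measurable borel"
    using measurable_slice[OF I] unfolding gabor_atom_def gauss_window_def by measurable
  then have [measurable]: "(\<lambda>t. slice I (gabor_atom z t)) \<in> borel_measurable lebesgue"
    by (intro measurable_completion) simp
  have [measurable]: "f \<in> borel_measurable lebesgue" using f by (simp add: L2_quat_def)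
  show "(\<lambda>t. slice I (gabor_atom z t) * f t) \<in> borel_measurable lebesgue" by measurable
qed (simp add: norm_quat_mult I)

text \<open>At this point the Segal-Bargmann kernel factors into a term independent of
  \<open>t\<close> and the atom, all within the commutative slice.\<close>

lemma bargmann_eq:
  assumes I: "I \<in> imag_units" and f: "f \<in> L2_quat"
  shows "bargmann f (qcnj (of_real x + I * of_real \<omega>) /\<^sub>R sqrt 2) =
    slice I (of_real (sqrt 2 * exp (pi * (x\<^sup>2 + \<omega>\<^sup>2) / 2)) * cis (pi * x * \<omega>))
      * (LINT t|lebesgue. slice I (gabor_atom (x, \<omega>) t) * f t)"
proof -
  define u where "u = (of_real x - \<i> * of_real \<omega>) / of_real (sqrt 2)"
  have q: "of_real x + I * of_real \<omega> = slice I (of_real x + \<i> * of_real \<omega>)"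
    by (simp add: slice_add slice_mult I)
  have u: "qcnj (of_real x + I * of_real \<omega>) /\<^sub>R sqrt 2 = slice I u"
    unfolding q slice_cnj[OF I, symmetric] slice_scaleR[symmetric]
    by (simp add: u_def scaleR_conv_of_real divide_inverse mult.commute)
  have s2: "(of_real (sqrt 2))\<^sup>2 = (2::complex)"
    by (simp flip: of_real_power)
  \<comment> \<open>The last two summands are the exponents of the window and of the modulation; the
    first two do not depend on \<open>t\<close>.\<close>
  have E: "- of_real pi * (u\<^sup>2 + (of_real t)\<^sup>2) + of_real (2 * pi * sqrt 2) * u * of_real t =
     of_real (pi * (x\<^sup>2 + \<omega>\<^sup>2) / 2) + \<i> * of_real (pi * x * \<omega>) + of_real (- pi * (t - x)\<^sup>2)
       + \<i> * of_real (- (2 * pi * \<omega> * t))" for t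
  proof -
    have "u\<^sup>2 = (of_real x - \<i> * of_real \<omega>)\<^sup>2 / 2"
      unfolding u_def power_divide s2 ..
    then have 1: "u\<^sup>2 = (of_real (x\<^sup>2) - of_real (\<omega>\<^sup>2) - 2 * \<i> * of_real (x * \<omega>)) / 2"
      by (simp add: power2_diff power_mult_distrib)
    have 2: "of_real (2 * pi * sqrt 2) * u = of_real (2 * pi) * (of_real x - \<i> * of_real \<omega>)"
      by (simp add: u_def)
    show ?thesis unfolding 1 2
      by (simp add: complex_eq_iff power2_eq_square field_simps)
  qed
  \<comment> \<open>The quarter power is absorbed by the window, leaving the factor
    \<open>sqrt 2\<close> of the transform.\<close>
  have c: "2 powr (3/4) = sqrt 2 * 2 powr (1/4)"
    by (simp add: powr_half_sqrt[symmetric] powr_add[symmetric])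
  have "of_real (2 powr (3/4)) * exp (- of_real pi * ((slice I u)\<^sup>2 + (of_real t)\<^sup>2)
          + of_real (2 * pi * sqrt 2) * slice I u * of_real t) =
        slice I (of_real (sqrt 2 * exp (pi * (x\<^sup>2 + \<omega>\<^sup>2) / 2)) * cis (pi * x * \<omega>))
          * slice I (gabor_atom (x, \<omega>) t)" for t
  proof -
    have "of_real (2 powr (3/4)) * exp (- of_real pi * ((slice I u)\<^sup>2 + (of_real t)\<^sup>2)
          + of_real (2 * pi * sqrt 2) * slice I u * of_real t) =
        slice I (of_real (2 powr (3/4))
          * exp (- of_real pi * (u\<^sup>2 + (of_real t)\<^sup>2) + of_real (2 * pi * sqrt 2) * u * of_real t))"
      by (simp add: slice_mult slice_exp slice_add slice_diff slice_minus slice_power I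
          del: of_real_mult of_real_add of_real_power flip: of_real_power)
    also have "\<dots> = slice I (of_real (sqrt 2 * exp (pi * (x\<^sup>2 + \<omega>\<^sup>2) / 2)) * cis (pi * x * \<omega>)
          * gabor_atom (x, \<omega>) t)"
      unfolding E unfolding exp_add exp_of_real unfolding c gabor_atom_def gauss_window_def cis_conv_exp of_real_mult
        fst_conv snd_conv
      by (simp only: mult_ac)
    finally show ?thesis by (simp add: slice_mult I)
  qed
  then have "bargmann f (slice I u) = (LINT t|lebesgue.
      slice I (of_real (sqrt 2 * exp (pi * (x\<^sup>2 + \<omega>\<^sup>2) / 2)) * cis (pi * x * \<omega>))
        * (slice I (gabor_atom (x, \<omega>) t) * f t))"
    by (simp add: bargmann_def mult.assoc)
  then show ?thesis
    unfolding u using integrable_slice_gabor_atom_mult[OF I f] by simp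
qed

text \<open>The outer phase and Gaussian in the definition of the transform cancel the prefactor of
  \<open>bargmann_eq\<close> except for \<open>sqrt 2\<close>.\<close>

lemma qstft_eq:
  assumes I: "I \<in> imag_units" and f: "f \<in> L2_quat"
  shows "qstft I f z = sqrt 2 *\<^sub>R (LINT t|lebesgue. slice I (gabor_atom z t) * f t)"
proof -
  obtain x \<omega> where z: "z = (x, \<omega>)" by (metis surj_pair)
  let ?V = "LINT t|lebesgue. slice I (gabor_atom (x, \<omega>) t) * f t"
  have q: "of_real x + I * of_real \<omega> = slice I (Complex x \<omega>)"
    by (simp add: slice_def quat_eq_iff)
  have n: "(norm (of_real x + I * of_real \<omega>))\<^sup>2 = x\<^sup>2 + \<omega>\<^sup>2"
    unfolding q norm_slice[OF I] by (simp add: cmod_power2)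
  have e: "exp (- I * of_real (pi * x * \<omega>)) = slice I (cis (- (pi * x * \<omega>)))"
    unfolding cis_conv_exp
    by (simp add: slice_exp slice_mult slice_minus I del: of_real_mult)
  \<comment> \<open>Reals are central, so the trailing Gaussian factor can be moved past the
    quaternionic integral.\<close>
  have r: "p * p' * of_real r = r *\<^sub>R (p * p')" for p p' :: quat and r
    by (simp add: quat_eq_iff)
  have "qstft I f z = exp (- pi * (x\<^sup>2 + \<omega>\<^sup>2) / 2) *\<^sub>R
      (slice I (cis (- (pi * x * \<omega>)) *
        (of_real (sqrt 2 * exp (pi * (x\<^sup>2 + \<omega>\<^sup>2) / 2)) * cis (pi * x * \<omega>))) * ?V)"
    unfolding z qstft_def prod.case Let_def n e bargmann_eq[OF I f] r slice_mult[OF I]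
    by (simp only: mult.assoc)
  also have "cis (- (pi * x * \<omega>)) *
        (of_real (sqrt 2 * exp (pi * (x\<^sup>2 + \<omega>\<^sup>2) / 2)) * cis (pi * x * \<omega>)) =
      of_real (sqrt 2 * exp (pi * (x\<^sup>2 + \<omega>\<^sup>2) / 2))"
    by (simp add: cis_mult mult.left_commute)
  also have "exp (- pi * (x\<^sup>2 + \<omega>\<^sup>2) / 2) *\<^sub>R
      (slice I (of_real (sqrt 2 * exp (pi * (x\<^sup>2 + \<omega>\<^sup>2) / 2))) * ?V) = sqrt 2 *\<^sub>R ?V"
  proof -
    have "exp (- pi * (x\<^sup>2 + \<omega>\<^sup>2) / 2) * exp (pi * (x\<^sup>2 + \<omega>\<^sup>2) / 2) = 1"
      by (simp add: exp_add[symmetric])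
    then have "exp (- pi * (x\<^sup>2 + \<omega>\<^sup>2) / 2) * (sqrt 2 * exp (pi * (x\<^sup>2 + \<omega>\<^sup>2) / 2)) = sqrt 2"
      by (simp only: mult.left_commute mult_1_right)
    then show ?thesis
      by (simp only: slice_of_real scaleR_conv_of_real[symmetric] scaleR_scaleR)
  qed
  finally show ?thesis by (simp add: z)
qed

text \<open>The integrand is the slice image of a product of one atom with a conjugate atom, and a
  bounded linear map commutes with the integral.\<close>

lemma gabor_kernel_eq:
  assumes I: "I \<in> imag_units"
  shows "gabor_kernel I gauss_window \<omega> x \<omega>' x' = slice I (gabor_gram (x, \<omega>) (x', \<omega>'))"
proof -
  have e: "exp (- 2 * of_real pi * I * of_real (a * t)) = slice I (cis (- (2 * pi * a * t)))" for a t
  proof -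
    have "- 2 * of_real pi * I * of_real (a * t) = of_real (- 2 * pi) * I * of_real (a * t)"
      by simp
    also have "\<dots> = slice I (\<i> * of_real (- (2 * pi * a * t)))"
      unfolding slice_mult[OF I] slice_of_real slice_ii
      by (simp only: quat_eq_iff quat_sel_times quat_sel_of_real) simp
    finally show ?thesis by (simp only: slice_exp[OF I] cis_conv_exp)
  qed
  have "gabor_kernel I gauss_window \<omega> x \<omega>' x' =
      (LINT t|lebesgue. slice I (gabor_atom (x', \<omega>') t * cnj (gabor_atom (x, \<omega>) t)))"
  proof -
    have "exp (- 2 * of_real pi * I * of_real (a * t)) * of_real (gauss_window (t - y)) =
        slice I (gabor_atom (y, a) t)" for a y t
      unfolding e gabor_atom_def slice_mult[OF I] slice_of_real fst_conv snd_conv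
      by (simp add: quat_eq_iff mult.commute)
    then show ?thesis
      unfolding gabor_kernel_def by (simp only: slice_mult[OF I] slice_cnj[OF I])
  qed
  also have "\<dots> = slice I (gabor_gram (x, \<omega>) (x', \<omega>'))"
    by (intro has_bochner_integral_integral_eq has_bochner_integral_completion
        has_bochner_integral_bounded_linear[OF bounded_linear_slice[OF I]]
        has_integral_gabor_atom_mult_cnj)
  finally show ?thesis .
qed

section \<open>Exchange of integrals and the reproducing formula\<close>

text \<open>Integrating the norm over \<open>t\<close> gives at most a constant times the norm of
  the kernel, which is integrable in \<open>z\<close>.\<close>

lemma integrable_gabor_gram_mult_slice_atom:
  assumes I: "I \<in> imag_units" and f: "f \<in> L2_quat"
  shows "integrable (lborel \<Otimes>\<^sub>M lebesgue)
    (\<lambda>(z, t). slice I (gabor_gram z w) * (slice I (gabor_atom z t) * f t))"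
proof -
  interpret L: sigma_finite_measure "lebesgue :: real measure"
    by (rule sigma_finite_completion[OF sigma_finite_lborel])
  interpret P: pair_sigma_finite "lborel :: (real \<times> real) measure" "lebesgue :: real measure" ..
  have fm [measurable]: "f \<in> borel_measurable lebesgue" using f by (simp add: L2_quat_def)
  note [measurable] = measurable_slice[OF I]
  have "(\<lambda>t::real. t) \<in> borel_measurable lebesgue"
    by (intro measurable_completion) simp
  \<comment> \<open>Joint Borel measurability of the atom is pulled back along this identity map to
    the product with the completed factor.\<close>
  then have "(\<lambda>p. (fst p, snd p)) \<in> lborel \<Otimes>\<^sub>M lebesgue \<rightarrow>\<^sub>M borel \<Otimes>\<^sub>M (borel :: real measure)"
    by (intro measurable_Pair measurable_fst'' measurable_compose[OF measurable_snd]) simp_all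
  from measurable_compose[OF this measurable_gabor_atom]
  have am [measurable]: "(\<lambda>p. gabor_atom (fst p) (snd p)) \<in> borel_measurable (lborel \<Otimes>\<^sub>M lebesgue)"
    by simp
  have H: "(\<lambda>(z, t). slice I (gabor_gram z w) * (slice I (gabor_atom z t) * f t))
      \<in> borel_measurable (lborel \<Otimes>\<^sub>M lebesgue)"
    unfolding split_beta by measurable
  let ?C = "(1 + (LINT t|lebesgue. (norm (f t))\<^sup>2)) / 2"
  show ?thesis
  proof (rule P.Fubini_integrable[OF H])
    have n: "(LINT t|lebesgue. norm (slice I (gabor_gram z w) * (slice I (gabor_atom z t) * f t))) =
      norm (gabor_gram z w) * (LINT t|lebesgue. gauss_window (t - fst z) * norm (f t))" for z
      by (simp add: norm_quat_mult I)
    have nonneg: "0 \<le> (LINT t|lebesgue. gauss_window (t - fst z) * norm (f t))" for z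
      by (simp add: integral_nonneg_AE)
    have "integrable lborel
      (\<lambda>z. LINT t|lebesgue. norm (slice I (gabor_gram z w) * (slice I (gabor_atom z t) * f t)))"
    proof (rule Bochner_Integration.integrable_bound)
      show "integrable lborel (\<lambda>z. norm (gabor_gram z w) * ?C)"
        by (intro integrable_mult_left integrable_norm integrable_gabor_gram)
      show "(\<lambda>z. LINT t|lebesgue. norm (slice I (gabor_gram z w) * (slice I (gabor_atom z t) * f t)))
          \<in> borel_measurable lborel"
        using measurable_compose[OF H borel_measurable_norm]
        by (intro L.borel_measurable_lebesgue_integral) (simp add: split_beta)
      show "AE z in lborel.
        norm (LINT t|lebesgue. norm (slice I (gabor_gram z w) * (slice I (gabor_atom z t) * f t)))
          \<le> norm (norm (gabor_gram z w) * ?C)"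
      proof (rule AE_I2)
        fix z :: "real \<times> real"
        have "(LINT t|lebesgue. gauss_window (t - fst z) * norm (f t)) \<le> \<bar>?C\<bar>"
          using integrable_gauss_window_mult_L2(2)[OF f, of "fst z"] by linarith
        then have "norm (gabor_gram z w) * (LINT t|lebesgue. gauss_window (t - fst z) * norm (f t))
            \<le> norm (gabor_gram z w) * \<bar>?C\<bar>"
          by (rule mult_left_mono) simp
        then show "norm (LINT t|lebesgue. norm (slice I (gabor_gram z w) * (slice I (gabor_atom z t) * f t)))
          \<le> norm (norm (gabor_gram z w) * ?C)"
          unfolding n real_norm_def abs_mult using nonneg[of z] by (simp only: abs_of_nonneg norm_ge_zero)
      qed
    qed
    then show "integrable lborel (\<lambda>z. LINT t|lebesgue.
        norm (case (z, t) of (z, t) \<Rightarrow> slice I (gabor_gram z w) * (slice I (gabor_atom z t) * f t)))"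
      by simp
    show "AE z in lborel. integrable lebesgue
        (\<lambda>t. case (z, t) of (z, t) \<Rightarrow> slice I (gabor_gram z w) * (slice I (gabor_atom z t) * f t))"
      using integrable_slice_gabor_atom_mult[OF I f] by simp
  qed
qed

lemma has_integral_gabor_gram_mult_qstft:
  assumes I: "I \<in> imag_units" and f: "f \<in> L2_quat"
  shows "has_bochner_integral lebesgue (\<lambda>z. slice I (gabor_gram z w) * qstft I f z) (qstft I f w)"
proof -
  interpret L: sigma_finite_measure "lebesgue :: real measure"
    by (rule sigma_finite_completion[OF sigma_finite_lborel])
  interpret P: pair_sigma_finite "lborel :: (real \<times> real) measure" "lebesgue :: real measure" ..
  let ?H = "\<lambda>z t. slice I (gabor_gram z w) * (slice I (gabor_atom z t) * f t)"
  note int = integrable_gabor_gram_mult_slice_atom[OF I f, of w]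
  have V: "slice I (gabor_gram z w) * qstft I f z = sqrt 2 *\<^sub>R (LINT t|lebesgue. ?H z t)" for z
    using integrable_slice_gabor_atom_mult[OF I f, of z] by (simp add: qstft_eq[OF I f])
  \<comment> \<open>For fixed \<open>t\<close> the value \<open>f t\<close> is a constant right
    factor, so associativity alone reduces this to the complex identity for atoms.\<close>
  have "(LINT z|lborel. ?H z t) = slice I (gabor_atom w t) * f t" for t
  proof -
    have "has_bochner_integral lborel (\<lambda>z. slice I (gabor_gram z w * gabor_atom z t) * f t)
        (slice I (gabor_atom w t) * f t)"
      by (intro has_bochner_integral_mult_left has_bochner_integral_bounded_linear[OF bounded_linear_slice[OF I]]
          has_integral_gabor_gram_mult_atom)
    then show ?thesis by (simp add: has_bochner_integral_iff slice_mult[OF I] mult.assoc)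
  qed
  then have "(LINT z|lborel. LINT t|lebesgue. ?H z t) = (LINT t|lebesgue. slice I (gabor_atom w t) * f t)"
    using P.Fubini_integral[OF int] by simp
  moreover have "integrable lborel (\<lambda>z. LINT t|lebesgue. ?H z t)"
    using P.integrable_fst'[OF int] by simp
  ultimately have "has_bochner_integral lborel (\<lambda>z. slice I (gabor_gram z w) * qstft I f z) (qstft I f w)"
    unfolding V qstft_eq[OF I f, of w] by (simp add: has_bochner_integral_iff)
  then show ?thesis by (rule has_bochner_integral_completion)
qed

text \<open>Supplies the membership half of the reproducing kernel property: every representer of
  evaluation is itself a transform.\<close>

lemma qcnj_gabor_gram_mem_gabor_space:
  assumes I: "I \<in> imag_units"
  shows "(\<lambda>z. qcnj (slice I (gabor_gram z w))) \<in> gabor_space I"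
proof -
  \<comment> \<open>The conjugate appears because the transform integrates against the unconjugated
    atom; the scalar cancels the \<open>sqrt 2\<close> of \<open>qstft_eq\<close>.\<close>
  define h where "h t = (1 / sqrt 2) *\<^sub>R slice I (cnj (gabor_atom w t))" for t
  have "h \<in> borel_measurable borel"
    using measurable_slice[OF I] unfolding h_def gabor_atom_def gauss_window_def by measurable
  then have "h \<in> borel_measurable lebesgue"
    by (intro measurable_completion) simp
  moreover have n: "(norm (h t))\<^sup>2 = (gauss_window (t - fst w))\<^sup>2 / 2" for t
    by (simp add: h_def I power_divide)
  moreover have "integrable lebesgue (\<lambda>t. (gauss_window (t - fst w))\<^sup>2)"
    using has_bochner_integral_completion[OF has_integral_gauss_window_sq, of "fst w"]
    by (simp add: has_bochner_integral_iff)
  then have "integrable lebesgue (\<lambda>t. (norm (h t))\<^sup>2)" unfolding n by simp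
  ultimately have h: "h \<in> L2_quat" by (simp add: L2_quat_def)
  have "qcnj (slice I (gabor_gram z w)) = qstft I h z" for z
  proof -
    have "slice I (gabor_atom z t) * h t =
        (1 / sqrt 2) *\<^sub>R slice I (gabor_atom z t * cnj (gabor_atom w t))" for t
      by (simp add: h_def slice_mult[OF I])
    moreover have "has_bochner_integral lebesgue
        (\<lambda>t. slice I (gabor_atom z t * cnj (gabor_atom w t))) (slice I (gabor_gram w z))"
      by (intro has_bochner_integral_completion
          has_bochner_integral_bounded_linear[OF bounded_linear_slice[OF I]]
          has_integral_gabor_atom_mult_cnj)
    ultimately have "qstft I h z = slice I (gabor_gram w z)"
      unfolding qstft_eq[OF I h]
      by (simp add: has_bochner_integral_iff)
    then show ?thesis by (simp add: slice_cnj[OF I, symmetric] cnj_gabor_gram)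
  qed
  then show ?thesis using h by (auto simp: gabor_space_def)
qed

theorem theorem5p12:
  fixes I :: quat and f :: "real \<Rightarrow> quat"
  assumes "I \<in> imag_units" and "f \<in> L2_quat"
  shows "reproducing_kernel_of (gabor_space I)
           (\<lambda>(x, \<omega>) (x', \<omega>'). gabor_kernel I gauss_window \<omega> x \<omega>' x') \<and>
         (\<forall>x' \<omega>'.
           integrable lebesgue
             (\<lambda>(x, \<omega>). gabor_kernel I gauss_window \<omega> x \<omega>' x' * qstft I f (x, \<omega>)) \<and>
           qstft I f (x', \<omega>') =
             (LINT (x, \<omega>)|lebesgue.
               gabor_kernel I gauss_window \<omega> x \<omega>' x' * qstft I f (x, \<omega>)))"
proof -
  have "(\<lambda>(x, \<omega>) (x', \<omega>'). gabor_kernel I gauss_window \<omega> x \<omega>' x') = (\<lambda>z w. slice I (gabor_gram z w))"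
    by (auto simp: fun_eq_iff gabor_kernel_eq[OF assms(1)])
  moreover have "(\<lambda>(x, \<omega>). gabor_kernel I gauss_window \<omega> x \<omega>' x' * qstft I f (x, \<omega>)) =
      (\<lambda>z. slice I (gabor_gram z (x', \<omega>')) * qstft I f z)" for x' \<omega>'
    by (auto simp: fun_eq_iff gabor_kernel_eq[OF assms(1)])
  \<comment> \<open>Every element of the space is the transform of some L2 function, so the formula
    for transforms covers the whole space.\<close>
  moreover have "reproducing_kernel_of (gabor_space I) (\<lambda>z w. slice I (gabor_gram z w))"
    unfolding reproducing_kernel_of_def
    using qcnj_gabor_gram_mem_gabor_space[OF assms(1)] has_integral_gabor_gram_mult_qstft[OF assms(1)]
    by (auto simp: gabor_space_def has_bochner_integral_iff)
  ultimately show ?thesis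
    using has_integral_gabor_gram_mult_qstft[OF assms] by (simp add: has_bochner_integral_iff)
qed

end
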